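(* Let $R$ be a unital ring. 1. If $M_R$ is a faithful right $R$-module then ${}'\mathcal{C}_M\subseteq{}'\mathcal{C}_R$. 2. If ${}_RM$ is a faithful left $R$-module then $\mathcal{C}'_M\subseteq\mathcal{C}'_R$. 3. If ${}_RM_R$ is an $R$-bimodule which is faithful as a left and as a right $R$-module then $\mathcal{C}_M\subseteq\mathcal{C}_R$. 4. If $I$ is an ideal of the ring $R$ which is faithful as a left and as a right $R$-module then $\mathcal{C}_I\subseteq\mathcal{C}_R$.
   Context: ${}'\mathcal{C}_R=\{c\in R\mid rc=0\Rightarrow r=0\}$, $\mathcal{C}'_R=\{c\in R\mid cr=0\Rightarrow r=0\}$, $\mathcal{C}_R={}'\mathcal{C}_R\cap\mathcal{C}'_R$. For a right $R$-module $M$, ${}'\mathcal{C}_M:=\{r\in R\mid\text{the map }M\to M,\ m\mapsto mr,\text{ is injective}\}$. For a left $R$-module $M$, $\mathcal{C}'_M:=\{r\in R\mid\text{the map }M\to M,\ m\mapsto rm,\text{ is injective}\}$. For an $R$-bimodule $M$, $\mathcal{C}_M:={}'\mathcal{C}_M\cap\mathcal{C}'_M$. *)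

theory Defs
  imports "HOL-Algebra.Module" "HOL-Algebra.Ideal"
begin

text \<open>
  The locale \<^locale>\<open>module\<close> of HOL-Algebra requires a commutative ring of scalars and has one action
  only, so one-sided modules and bimodules over an arbitrary unital ring are defined here. The underlying
  abelian group of a module is a record of type \<^typ>\<open>('m, 'f) ring_scheme\<close>, as in
  \<^locale>\<open>abelian_group\<close>; its multiplication and unit play no role. The actions are separate
  parameters, so that a bimodule is one abelian group with two actions. Modules are unitary.
\<close>

locale left_module = R: ring R + M: abelian_group M
  for R :: "('a, 'e) ring_scheme" and M :: "('m, 'f) ring_scheme" +
  fixes lact :: "'a \<Rightarrow> 'm \<Rightarrow> 'm"
  assumes lact_closed: "\<lbrakk>r \<in> carrier R; m \<in> carrier M\<rbrakk> \<Longrightarrow> lact r m \<in> carrier M"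
    and lact_l_distr: "\<lbrakk>r \<in> carrier R; s \<in> carrier R; m \<in> carrier M\<rbrakk>
      \<Longrightarrow> lact (r \<oplus>\<^bsub>R\<^esub> s) m = lact r m \<oplus>\<^bsub>M\<^esub> lact s m"
    and lact_r_distr: "\<lbrakk>r \<in> carrier R; m \<in> carrier M; n \<in> carrier M\<rbrakk>
      \<Longrightarrow> lact r (m \<oplus>\<^bsub>M\<^esub> n) = lact r m \<oplus>\<^bsub>M\<^esub> lact r n"
    and lact_assoc: "\<lbrakk>r \<in> carrier R; s \<in> carrier R; m \<in> carrier M\<rbrakk>
      \<Longrightarrow> lact (r \<otimes>\<^bsub>R\<^esub> s) m = lact r (lact s m)"
    and lact_one: "m \<in> carrier M \<Longrightarrow> lact \<one>\<^bsub>R\<^esub> m = m"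

locale right_module = R: ring R + M: abelian_group M
  for R :: "('a, 'e) ring_scheme" and M :: "('m, 'f) ring_scheme" +
  fixes ract :: "'m \<Rightarrow> 'a \<Rightarrow> 'm"
  assumes ract_closed: "\<lbrakk>m \<in> carrier M; r \<in> carrier R\<rbrakk> \<Longrightarrow> ract m r \<in> carrier M"
    and ract_l_distr: "\<lbrakk>m \<in> carrier M; n \<in> carrier M; r \<in> carrier R\<rbrakk>
      \<Longrightarrow> ract (m \<oplus>\<^bsub>M\<^esub> n) r = ract m r \<oplus>\<^bsub>M\<^esub> ract n r"
    and ract_r_distr: "\<lbrakk>m \<in> carrier M; r \<in> carrier R; s \<in> carrier R\<rbrakk>
      \<Longrightarrow> ract m (r \<oplus>\<^bsub>R\<^esub> s) = ract m r \<oplus>\<^bsub>M\<^esub> ract m s"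
    and ract_assoc: "\<lbrakk>m \<in> carrier M; r \<in> carrier R; s \<in> carrier R\<rbrakk>
      \<Longrightarrow> ract m (r \<otimes>\<^bsub>R\<^esub> s) = ract (ract m r) s"
    and ract_one: "m \<in> carrier M \<Longrightarrow> ract m \<one>\<^bsub>R\<^esub> = m"

locale bimodule = left_module R M lact + right_module R M ract
  for R :: "('a, 'e) ring_scheme" and M :: "('m, 'f) ring_scheme"
    and lact :: "'a \<Rightarrow> 'm \<Rightarrow> 'm" and ract :: "'m \<Rightarrow> 'a \<Rightarrow> 'm" +
  assumes lact_ract: "\<lbrakk>r \<in> carrier R; m \<in> carrier M; s \<in> carrier R\<rbrakk>
      \<Longrightarrow> ract (lact r m) s = lact r (ract m s)"

definition faithful_left ::
    "('a, 'e) ring_scheme \<Rightarrow> ('m, 'f) ring_scheme \<Rightarrow> ('a \<Rightarrow> 'm \<Rightarrow> 'm) \<Rightarrow> bool" where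
  "faithful_left R M lact \<longleftrightarrow>
     {r \<in> carrier R. \<forall>m\<in>carrier M. lact r m = \<zero>\<^bsub>M\<^esub>} = {\<zero>\<^bsub>R\<^esub>}"

definition faithful_right ::
    "('a, 'e) ring_scheme \<Rightarrow> ('m, 'f) ring_scheme \<Rightarrow> ('m \<Rightarrow> 'a \<Rightarrow> 'm) \<Rightarrow> bool" where
  "faithful_right R M ract \<longleftrightarrow>
     {r \<in> carrier R. \<forall>m\<in>carrier M. ract m r = \<zero>\<^bsub>M\<^esub>} = {\<zero>\<^bsub>R\<^esub>}"

text \<open>
  \<open>prime_C\<close> is the set with the prime on the left of the letter C (right multiplication by the
  element is injective), \<open>C_prime\<close> the one with the prime on the right (left multiplication is
  injective); \<open>C\<close> without a prime is their intersection.
\<close>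

definition prime_C_ring :: "('a, 'e) ring_scheme \<Rightarrow> 'a set" where
  "prime_C_ring R =
     {c \<in> carrier R. \<forall>r\<in>carrier R. r \<otimes>\<^bsub>R\<^esub> c = \<zero>\<^bsub>R\<^esub> \<longrightarrow> r = \<zero>\<^bsub>R\<^esub>}"

definition C_prime_ring :: "('a, 'e) ring_scheme \<Rightarrow> 'a set" where
  "C_prime_ring R =
     {c \<in> carrier R. \<forall>r\<in>carrier R. c \<otimes>\<^bsub>R\<^esub> r = \<zero>\<^bsub>R\<^esub> \<longrightarrow> r = \<zero>\<^bsub>R\<^esub>}"

definition C_ring :: "('a, 'e) ring_scheme \<Rightarrow> 'a set" where
  "C_ring R = prime_C_ring R \<inter> C_prime_ring R"

definition prime_C_module ::
    "('a, 'e) ring_scheme \<Rightarrow> ('m, 'f) ring_scheme \<Rightarrow> ('m \<Rightarrow> 'a \<Rightarrow> 'm) \<Rightarrow> 'a set" where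
  "prime_C_module R M ract = {r \<in> carrier R. inj_on (\<lambda>m. ract m r) (carrier M)}"

definition C_prime_module ::
    "('a, 'e) ring_scheme \<Rightarrow> ('m, 'f) ring_scheme \<Rightarrow> ('a \<Rightarrow> 'm \<Rightarrow> 'm) \<Rightarrow> 'a set" where
  "C_prime_module R M lact = {r \<in> carrier R. inj_on (\<lambda>m. lact r m) (carrier M)}"

definition C_bimodule ::
    "('a, 'e) ring_scheme \<Rightarrow> ('m, 'f) ring_scheme
      \<Rightarrow> ('a \<Rightarrow> 'm \<Rightarrow> 'm) \<Rightarrow> ('m \<Rightarrow> 'a \<Rightarrow> 'm) \<Rightarrow> 'a set" where
  "C_bimodule R M lact ract = prime_C_module R M ract \<inter> C_prime_module R M lact"

text \<open>A two-sided ideal is regarded as a bimodule with the multiplication of the ring as both actions.\<close>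

abbreviation ideal_group :: "('a, 'e) ring_scheme \<Rightarrow> 'a set \<Rightarrow> ('a, 'e) ring_scheme" where
  "ideal_group R I \<equiv> R\<lparr>carrier := I\<rparr>"

lemma ideal_bimodule:
  assumes "ideal I R"
  shows "bimodule R (ideal_group R I) (\<otimes>\<^bsub>R\<^esub>) (\<otimes>\<^bsub>R\<^esub>)"
proof -
  interpret ideal I R by (rule assms)
  have ab: "abelian_group (ideal_group R I)"
  proof (rule abelian_groupI)
    fix x assume "x \<in> carrier (ideal_group R I)"
    then show "\<exists>y\<in>carrier (ideal_group R I). y \<oplus>\<^bsub>ideal_group R I\<^esub> x = \<zero>\<^bsub>ideal_group R I\<^esub>"
      using a_inv_closed l_neg a_subset by (intro bexI[of _ "\<ominus>\<^bsub>R\<^esub> x"]) auto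
  qed (use a_subset in \<open>auto simp: a_ac subset_iff\<close>)
  have rg: "ring R" by unfold_locales
  have sub: "x \<in> carrier R" if "x \<in> I" for x using that a_subset by auto
  show ?thesis
    by (intro bimodule.intro left_module.intro right_module.intro left_module_axioms.intro
          right_module_axioms.intro bimodule_axioms.intro ab rg)
      (auto simp: sub I_l_closed I_r_closed l_distr r_distr m_assoc)
qed

end

theory Submission
  imports Defs
begin

text \<open>Let right multiplication by c be injective on M, and let rc = 0. Then (Mr)c = M(rc) = 0,
  so injectivity gives Mr = 0, and faithfulness gives r = 0. This is
  \<open>prime_C_module_subset\<close>; its mirror image \<open>C_prime_module_subset\<close> treats
  left modules. Bimodules combine the two, and an ideal is a bimodule under the multiplication of
  the ring.\<close>

lemma (in abelian_group) add_idem_imp_zero: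
  assumes "x \<in> carrier G" and "x = x \<oplus> x"
  shows "x = \<zero>"
  using assms add.r_cancel_one' by blast

text \<open>The module axioms state additivity but no zero laws. Since 0 + 0 = 0, the value x in
  question satisfies x = x + x and so vanishes; the next three lemmas follow the same
  pattern.\<close>

lemma (in right_module) ract_zero_left:
  assumes "r \<in> carrier R"
  shows "ract \<zero>\<^bsub>M\<^esub> r = \<zero>\<^bsub>M\<^esub>"
  using M.add_idem_imp_zero[of "ract \<zero>\<^bsub>M\<^esub> r"] ract_l_distr[of "\<zero>\<^bsub>M\<^esub>" "\<zero>\<^bsub>M\<^esub>" r] assms
  by (simp add: ract_closed)

lemma (in right_module) ract_zero_right:
  assumes "m \<in> carrier M"
  shows "ract m \<zero>\<^bsub>R\<^esub> = \<zero>\<^bsub>M\<^esub>"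
  using M.add_idem_imp_zero[of "ract m \<zero>\<^bsub>R\<^esub>"] ract_r_distr[of m "\<zero>\<^bsub>R\<^esub>" "\<zero>\<^bsub>R\<^esub>"] assms
  by (simp add: ract_closed)

lemma (in left_module) lact_zero_left:
  assumes "m \<in> carrier M"
  shows "lact \<zero>\<^bsub>R\<^esub> m = \<zero>\<^bsub>M\<^esub>"
  using M.add_idem_imp_zero[of "lact \<zero>\<^bsub>R\<^esub> m"] lact_l_distr[of "\<zero>\<^bsub>R\<^esub>" "\<zero>\<^bsub>R\<^esub>" m] assms
  by (simp add: lact_closed)

lemma (in left_module) lact_zero_right:
  assumes "r \<in> carrier R"
  shows "lact r \<zero>\<^bsub>M\<^esub> = \<zero>\<^bsub>M\<^esub>"
  using M.add_idem_imp_zero[of "lact r \<zero>\<^bsub>M\<^esub>"] lact_r_distr[of r "\<zero>\<^bsub>M\<^esub>" "\<zero>\<^bsub>M\<^esub>"] assms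
  by (simp add: lact_closed)

lemma (in right_module) prime_C_module_subset:
  assumes "faithful_right R M ract"
  shows "prime_C_module R M ract \<subseteq> prime_C_ring R"
proof
  fix c assume "c \<in> prime_C_module R M ract"
  then have c: "c \<in> carrier R" and inj: "inj_on (\<lambda>m. ract m c) (carrier M)"
    by (auto simp: prime_C_module_def)
  have "r = \<zero>\<^bsub>R\<^esub>" if r: "r \<in> carrier R" and rc: "r \<otimes>\<^bsub>R\<^esub> c = \<zero>\<^bsub>R\<^esub>" for r
  proof -
    have "ract m r = \<zero>\<^bsub>M\<^esub>" if m: "m \<in> carrier M" for m
    proof (rule inj_onD[OF inj])
      \<comment> \<open>Both sides vanish: the left one is m(rc) = m0. Injectivity then cancels c
        and leaves mr = 0.\<close>
      show "ract (ract m r) c = ract \<zero>\<^bsub>M\<^esub> c"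
        by (simp add: ract_assoc[OF m r c, symmetric] rc ract_zero_left ract_zero_right m c)
    qed (simp_all add: ract_closed m r)
    then show ?thesis
      using assms r by (auto simp: faithful_right_def)
  qed
  then show "c \<in> prime_C_ring R"
    using c by (simp add: prime_C_ring_def)
qed

text \<open>In a left module c acts after r in (cr)m = c(rm), so injectivity of c now cancels a left
  factor, and r annihilates M whenever cr = 0.\<close>

lemma (in left_module) C_prime_module_subset:
  assumes "faithful_left R M lact"
  shows "C_prime_module R M lact \<subseteq> C_prime_ring R"
proof
  fix c assume "c \<in> C_prime_module R M lact"
  then have c: "c \<in> carrier R" and inj: "inj_on (\<lambda>m. lact c m) (carrier M)"
    by (auto simp: C_prime_module_def)
  have "r = \<zero>\<^bsub>R\<^esub>" if r: "r \<in> carrier R" and cr: "c \<otimes>\<^bsub>R\<^esub> r = \<zero>\<^bsub>R\<^esub>" for r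
  proof -
    have "lact r m = \<zero>\<^bsub>M\<^esub>" if m: "m \<in> carrier M" for m
    proof (rule inj_onD[OF inj])
      show "lact c (lact r m) = lact c \<zero>\<^bsub>M\<^esub>"
        by (simp add: lact_assoc[OF c r m, symmetric] cr lact_zero_left lact_zero_right m c)
    qed (simp_all add: lact_closed m r)
    then show ?thesis
      using assms r by (auto simp: faithful_left_def)
  qed
  then show "c \<in> C_prime_ring R"
    using c by (simp add: C_prime_ring_def)
qed

text \<open>Both sides are intersections, so the two one-sided inclusions suffice.\<close>

lemma (in bimodule) C_bimodule_subset:
  assumes "faithful_left R M lact" and "faithful_right R M ract"
  shows "C_bimodule R M lact ract \<subseteq> C_ring R"
  using C_prime_module_subset prime_C_module_subset assms
  unfolding C_bimodule_def C_ring_def by blast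

theorem lemma2p16:
  fixes R :: "('a, 'e) ring_scheme"
  assumes "ring R"
  shows
    "(\<forall>(M :: ('m1, 'f1) ring_scheme) ract.
        right_module R M ract \<and> faithful_right R M ract
          \<longrightarrow> prime_C_module R M ract \<subseteq> prime_C_ring R)
   \<and> (\<forall>(M :: ('m2, 'f2) ring_scheme) lact.
        left_module R M lact \<and> faithful_left R M lact
          \<longrightarrow> C_prime_module R M lact \<subseteq> C_prime_ring R)
   \<and> (\<forall>(M :: ('m3, 'f3) ring_scheme) lact ract.
        bimodule R M lact ract \<and> faithful_left R M lact \<and> faithful_right R M ract
          \<longrightarrow> C_bimodule R M lact ract \<subseteq> C_ring R)
   \<and> (\<forall>I. ideal I R
          \<and> faithful_left R (ideal_group R I) (\<otimes>\<^bsub>R\<^esub>)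
          \<and> faithful_right R (ideal_group R I) (\<otimes>\<^bsub>R\<^esub>)
          \<longrightarrow> C_bimodule R (ideal_group R I) (\<otimes>\<^bsub>R\<^esub>) (\<otimes>\<^bsub>R\<^esub>) \<subseteq> C_ring R)"
  by (intro conjI allI impI; elim conjE)
    \<comment> \<open>For an ideal the plain bimodule rule also unifies, but its
      \<open>bimodule\<close> premise is not among the assumptions; backtracking reaches the last
      rule, where \<open>ideal_bimodule\<close> has reduced that premise to
      \<open>ideal I R\<close>.\<close>
    (rule right_module.prime_C_module_subset left_module.C_prime_module_subset
      bimodule.C_bimodule_subset bimodule.C_bimodule_subset[OF ideal_bimodule]; assumption)+

end
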